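(* Let $\theta\in(0,1)$ be irrational with $\theta^2=1/m$ for some $m\in\mathbb{N}_+$. For every $\varepsilon>0$, \[ \lim_{n\to\infty}\gamma_\theta\!\left(\left\{x\in[0,\theta]:\left|\frac{S_{n,\theta}(x)}{n\log n}-\frac{1}{\log(1+\theta^2)}\right|>\varepsilon\right\}\right)=0, \] i.e. $S_{n,\theta}/(n\log n)\to 1/\log(1+\theta^2)$ in $\gamma_\theta$-probability.
   Context: Let $m\in\mathbb{N}_+$ not be a perfect square and $\theta=1/\sqrt m\in(0,1)$ (so $\theta$ is irrational and $\theta^2=1/m$). The map $T_\theta:[0,\theta]\to[0,\theta]$ is $T_\theta(x)=\frac1x-\theta\lfloor\frac{1}{\theta x}\rfloor$ for $x\in(0,\theta]$ and $T_\theta(0)=0$. The digits of $x$ are $\ell_n(x)=\lfloor \frac{1}{\theta T_\theta^{n-1}(x)}\rfloor$ for $n\ge1$ (with $T_\theta^0(x)=x$); they take values in $\{m,m+1,\dots\}$ and are defined for almost every $x$ (e.g. all irrational $x\in(0,\theta]$). The probability measure $\gamma_\theta$ on $[0,\theta]$ has density $\frac{1}{\log(1+\theta^2)}\cdot\frac{\theta}{1+\theta x}$ with respect to Lebesgue measure; it is $T_\theta$-invariant and ergodic. Define $S_{n,\theta}(x)=\sum_{k=1}^n\ell_k(x)$. *)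

theory Defs
  imports "HOL-Probability.Probability"
begin

definition T_theta :: "real \<Rightarrow> real \<Rightarrow> real" where
  "T_theta \<theta> x = (if x = 0 then 0 else 1 / x - \<theta> * of_int \<lfloor>1 / (\<theta> * x)\<rfloor>)"

definition digit :: "real \<Rightarrow> nat \<Rightarrow> real \<Rightarrow> int" where
  "digit \<theta> n x = \<lfloor>1 / (\<theta> * (T_theta \<theta> ^^ (n - 1)) x)\<rfloor>"

definition S_theta :: "real \<Rightarrow> nat \<Rightarrow> real \<Rightarrow> real" where
  "S_theta \<theta> n x = (\<Sum>k=1..n. real_of_int (digit \<theta> k x))"

definition gamma_theta :: "real \<Rightarrow> real measure" where
  "gamma_theta \<theta> = density (restrict_space lborel {0..\<theta>})
     (\<lambda>x. ennreal (1 / ln (1 + \<theta>\<^sup>2) * (\<theta> / (1 + \<theta> * x))))"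

end

theory Submission
  imports Defs
begin

text \<open>Digits have a heavy tail, \<open>\<gamma>(\<ell>\<^sub>1 \<ge> k) = ln (1 + 1/k) / ln (1 + \<theta>\<^sup>2)\<close> for \<open>k \<ge> m\<close>, so the weak law is obtained by
  truncating them at a level \<open>B\<close> close to \<open>n ln n\<close>. The truncated digit has mean \<open>\<sim> ln B / ln (1 + \<theta>\<^sup>2)\<close> and
  second moment \<open>O(B)\<close>, and truncation changes the sum with probability \<open>O(n / B)\<close>. For the covariances, the
  transfer operator of the map contracts Lipschitz constants, and it sends the truncated digit to a
  function with Lipschitz constant \<open>O(ln B)\<close>; hence the truncated digits at times \<open>j\<close> and \<open>k\<close> have covariance
  at most \<open>O(q ^ \<bar>j - k\<bar> (ln B)\<^sup>2)\<close> with \<open>q < 1\<close>, and Chebyshev's inequality applies.\<close>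

section \<open>Summation by parts, geometric row sums and harmonic numbers\<close>

lemma sums_by_parts:
  fixes a f :: "nat \<Rightarrow> real"
  assumes a: "a \<longlonglongrightarrow> 0" and f: "Bseq f"
    and s: "(\<lambda>j. (a j - a (Suc j)) * f j) sums s"
  shows "(\<lambda>j. a (Suc j) * (f (Suc j) - f j)) sums (s - a 0 * f 0)"
proof -
  \<comment> \<open>A null sequence times a bounded one is null, so the products telescope to
    \<open>a 0 * f 0\<close>; subtracting this series from \<open>s\<close> moves the difference
    from \<open>a\<close> to \<open>f\<close>.\<close>
  have "(\<lambda>j. a j * f j) \<longlonglongrightarrow> 0"
    using f by (auto simp: Bfun_def intro: lim_null_mult_right_bounded[OF a])
  from telescope_sums'[OF this] have "(\<lambda>j. a j * f j - a (Suc j) * f (Suc j)) sums (a 0 * f 0)"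
    by simp
  from sums_diff[OF s this] show ?thesis
    by (simp add: algebra_simps)
qed

text \<open>Uniform row sum for covariances decaying geometrically off the diagonal. The row is
  split at \<open>j\<close> into two geometric series, both of which include the diagonal term;
  hence the factor 2.\<close>

lemma sum_power_dist_le:
  fixes q :: real
  assumes q: "0 \<le> q" "q < 1"
  shows "(\<Sum>k<n. q ^ nat \<bar>int j - int k\<bar>) \<le> 2 / (1 - q)"
proof -
  have geom: "sum ((^) q) A \<le> 1 / (1 - q)" if "finite A" for A
    using q that by (subst suminf_geometric[symmetric]) (auto intro!: sum_le_suminf summable_geometric)
  have "(\<Sum>k<n. q ^ nat \<bar>int j - int k\<bar>) \<le> (\<Sum>k\<in>{..j} \<union> {j..<j+n}. q ^ nat \<bar>int j - int k\<bar>)"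
    using q by (intro sum_mono2) auto
  also have "\<dots> \<le> (\<Sum>k\<in>{..j}. q ^ nat \<bar>int j - int k\<bar>) + (\<Sum>k\<in>{j..<j+n}. q ^ nat \<bar>int j - int k\<bar>)"
    using q by (subst sum_Un) (auto intro!: sum_nonneg)
  also have "(\<Sum>k\<in>{..j}. q ^ nat \<bar>int j - int k\<bar>) = (\<Sum>i\<in>{..j}. q ^ i)"
    by (rule sum.reindex_bij_witness[of _ "\<lambda>i. j - i" "\<lambda>k. j - k"]) (auto simp: nat_diff_distrib of_nat_diff)
  also have "(\<Sum>k\<in>{j..<j+n}. q ^ nat \<bar>int j - int k\<bar>) = (\<Sum>i<n. q ^ i)"
    by (rule sum.reindex_bij_witness[of _ "\<lambda>i. j + i" "\<lambda>k. k - j"]) (auto simp: nat_diff_distrib of_nat_diff abs_if)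
  finally show ?thesis using geom[of "{..j}"] geom[of "{..<n}"] by simp
qed

text \<open>The difference of the two sequences decreases from its value 1 at
  \<open>n = 1\<close>.\<close>

lemma harm_le_ln: assumes "1 \<le> n" shows "harm n \<le> 1 + ln (real n)"
proof -
  have "harm (Suc (n - 1)) - ln (real (Suc (n - 1))) \<le> harm (Suc 0) - ln (real (Suc 0))"
    by (rule decseqD[OF decseq_harm_diff_ln]) simp
  then show ?thesis using assms by (simp add: harm_def)
qed

section \<open>The rescaled map, its inverse branches and its invariant measure\<close>

locale n_fraction =
  fixes m :: nat
  assumes m_ge_2: "2 \<le> m"
begin

text \<open>Coordinates: \<open>x = \<theta>u\<close> with \<open>u \<in> [0, 1]\<close>. Then \<open>T_theta\<close> becomes \<open>u \<mapsto> frac (m / u)\<close> and \<open>gamma_theta\<close> has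
  density \<open>h u = c / (m + u)\<close>. The inverse branches are the \<open>v j\<close>, the branch \<open>v j\<close> carrying the digit
  \<open>m + j\<close>; the weights are \<open>p j u = h (v j u) \<bar>(v j)' u\<bar> / h u\<close>, and \<open>tail j\<close> is \<open>p j + p (j + 1) + \<dots>\<close>.\<close>

definition c :: real where "c = 1 / ln (1 + 1 / real m)"
definition M :: "real measure"
  where "M = density lborel (\<lambda>u. ennreal (indicator {0..1} u * (c / (real m + u))))"
definition T :: "real \<Rightarrow> real" where "T u = frac (real m / u)"
definition dig :: "real \<Rightarrow> int" where "dig u = \<lfloor>real m / u\<rfloor>"
definition p :: "nat \<Rightarrow> real \<Rightarrow> real"
  where "p j u = (real m + u) / ((real m + real j + u) * (real m + real j + u + 1))"
definition v :: "nat \<Rightarrow> real \<Rightarrow> real" where "v j u = real m / (real m + real j + u)"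
definition tail :: "nat \<Rightarrow> real \<Rightarrow> real" where "tail j u = (real m + u) / (real m + real j + u)"

lemma m_pos: "real m > 0" and m_ge: "real m \<ge> 2" using m_ge_2 by auto

lemma ln_m_pos: "ln (1 + 1 / real m) > 0"
  using m_pos by (intro ln_gt_zero) simp

lemma c_pos: "c > 0"
  unfolding c_def using ln_m_pos by simp

lemma p_eq_tail_diff: assumes "0 \<le> u" shows "p j u = tail j u - tail (Suc j) u"
proof -
  have 1: "real m + real j + u > 0" "real m + real j + u + 1 > 0" using m_pos assms by auto
  show ?thesis unfolding p_def tail_def using 1
    by (simp add: divide_simps add.commute add.left_commute) (simp add: algebra_simps)
qed

lemma tail_tendsto_0: "(\<lambda>j. tail j u) \<longlonglongrightarrow> 0"
  unfolding tail_def by real_asymp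

lemma p_nonneg: "0 \<le> u \<Longrightarrow> 0 \<le> p j u"
  unfolding p_def using m_pos by auto

text \<open>The weights telescope from \<open>tail 0 u = 1\<close> to the limit 0. This
  normalisation is what makes \<open>M\<close> invariant under \<open>T\<close>.\<close>

lemma p_sums_1: assumes "0 \<le> u" shows "(\<lambda>j. p j u) sums 1"
proof -
  have "tail 0 u = 1" using m_pos assms by (simp add: tail_def)
  then show ?thesis
    using telescope_sums'[OF tail_tendsto_0[of u]] by (simp add: p_eq_tail_diff assms)
qed

lemma v_in: "0 \<le> u \<Longrightarrow> v j u \<in> {0<..1}"
  unfolding v_def using m_pos by (auto simp: divide_simps)

lemma real_m_div_v: "0 \<le> u \<Longrightarrow> real m / v j u = real (m + j) + u"
  unfolding v_def using m_pos by (auto simp: divide_simps)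

text \<open>The endpoint \<open>u = 1\<close> is excluded: there \<open>m / v j u\<close> is the
  integer \<open>m + j + 1\<close>, so \<open>T\<close> gives 0 and the digit jumps by one.
  \<open>AE_M\<close> discards this point.\<close>

lemma T_v: "u \<in> {0..<1} \<Longrightarrow> T (v j u) = u"
  unfolding T_def real_m_div_v by (simp add: real_m_div_v frac_unique_iff)

lemma dig_v: "u \<in> {0..<1} \<Longrightarrow> dig (v j u) = int (m + j)"
  unfolding dig_def by (simp add: real_m_div_v floor_eq_iff)

lemma T_measurable [measurable]: "T \<in> borel_measurable borel"
  unfolding T_def frac_def by measurable

lemma dig_measurable [measurable]: "dig \<in> measurable borel (count_space UNIV)"
  unfolding dig_def by measurable

lemma funpow_T_measurable [measurable]: "(T ^^ n) \<in> borel_measurable borel"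
  by (induction n) (auto intro: measurable_comp)

lemma p_measurable [measurable]: "p j \<in> borel_measurable borel"
  and v_measurable [measurable]: "v j \<in> borel_measurable borel"
  unfolding p_def v_def by measurable

lemma sets_M [measurable_cong]: "sets M = sets borel" and space_M: "space M = UNIV"
  unfolding M_def by auto

lemma nn_integral_M:
  assumes [measurable]: "\<phi> \<in> borel_measurable borel"
  shows "(\<integral>\<^sup>+u. \<phi> u \<partial>M) = (\<integral>\<^sup>+u. \<phi> u * ennreal (c / (real m + u)) * indicator {0..1} u \<partial>lborel)"
  unfolding M_def by (subst nn_integral_density)
    (auto intro!: nn_integral_cong simp: indicator_def mult.commute)

lemma emeasure_M_Icc:
  assumes "0 \<le> t" "t \<le> 1"
  shows "emeasure M {0..t} = ennreal (c * ln (1 + t / real m))"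
proof -
  have "emeasure M {0..t} = (\<integral>\<^sup>+u. indicator {0..t} u \<partial>M)"
    by (simp add: sets_M)
  also have "\<dots> = (\<integral>\<^sup>+u. ennreal (c / (real m + u)) * indicator {0..t} u \<partial>lborel)"
    using assms by (subst nn_integral_M) (auto intro!: nn_integral_cong simp: indicator_def)
  also have "\<dots> = ennreal (c * ln (real m + t) - c * ln (real m + 0))"
    using m_pos c_pos assms
    by (intro nn_integral_FTC_Icc) (auto intro!: derivative_eq_intros)
  also have "c * ln (real m + t) - c * ln (real m + 0) = c * ln (1 + t / real m)"
    using m_pos assms by (simp flip: right_diff_distrib ln_divide_pos add: add_divide_distrib)
  finally show ?thesis .
qed

lemma AE_M: "AE u in M. u \<in> {0<..<1}"
proof -
  have "AE u in lborel. u \<noteq> (0::real) \<and> u \<noteq> 1"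
    using AE_lborel_singleton[of 0] AE_lborel_singleton[of 1] by eventually_elim simp
  then show ?thesis
    unfolding M_def
    by (subst AE_density, measurable, elim eventually_mono) (auto simp: indicator_def less_le)
qed

lemma prob_space_M: "prob_space M"
proof
  have "emeasure M (space M) = emeasure M {0..1}"
    using AE_M by (intro emeasure_eq_AE) (auto simp: sets_M space_M)
  also have "\<dots> = 1"
    using ln_m_pos by (subst emeasure_M_Icc) (auto simp: c_def)
  finally show "emeasure M (space M) = 1" .
qed

sublocale prob_space M by (rule prob_space_M)

lemma branch_substitution:
  assumes [measurable]: "\<phi> \<in> borel_measurable borel"
  shows "(\<integral>\<^sup>+u. \<phi> u * indicator {real m / real (m + j + 1)..real m / real (m + j)} u \<partial>lborel) =
    (\<integral>\<^sup>+u. \<phi> (v j u) * ennreal (real m / (real m + real j + u)\<^sup>2) * indicator {0..1} u \<partial>lborel)"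
proof -
  \<comment> \<open>The branch \<open>v j\<close> is decreasing, so the substitution is made with
    its increasing reflection \<open>g u = v j (1 - u)\<close>, and \<open>u\<close> is then
    replaced by \<open>1 - u\<close>.\<close>
  define g where "g u = real m / (real m + real j + 1 - u)" for u
  define g' where "g' u = real m / (real m + real j + 1 - u)\<^sup>2" for u
  have "(\<integral>\<^sup>+u. \<phi> u * indicator {g 0..g 1} u \<partial>lborel) =
      (\<integral>\<^sup>+u. \<phi> (g u) * ennreal (g' u) * indicator {0..1} u \<partial>lborel)"
    using m_pos
    by (intro nn_integral_substitution_aux)
       (auto simp: g_def g'_def intro!: derivative_eq_intros continuous_intros
         simp: power2_eq_square)
  also have "\<dots> = ennreal \<bar>-1\<bar> * (\<integral>\<^sup>+u. \<phi> (g (1 + (-1) * u)) * ennreal (g' (1 + (-1) * u)) * indicator {0..1} (1 + (-1) * u) \<partial>lborel)"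
    unfolding g_def g'_def by (rule nn_integral_real_affine) auto
  also have "\<dots> = (\<integral>\<^sup>+u. \<phi> (v j u) * ennreal (real m / (real m + real j + u)\<^sup>2) * indicator {0..1} u \<partial>lborel)"
    by (auto intro!: nn_integral_cong simp: g_def g'_def v_def indicator_def algebra_simps)
  finally show ?thesis by (simp add: g_def algebra_simps)
qed

lemma mem_branch_iff_digit:
  assumes "u \<in> {0<..1::real}"
  shows "u \<in> {real m / real (m + j + 1)<..real m / real (m + j)} \<longleftrightarrow> j = nat (dig u) - m"
proof -
  have 1: "real m \<le> real m / u" using assms m_pos by (simp add: field_simps)
  \<comment> \<open>This makes the truncated subtraction \<open>nat (dig u) - m\<close>
    exact.\<close>
  then have 2: "int m \<le> dig u" unfolding dig_def by linarith
  have "u \<in> {real m / real (m + j + 1)<..real m / real (m + j)} \<longleftrightarrow>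
      real m / u < real (m + j + 1) \<and> real (m + j) \<le> real m / u"
    using assms m_pos by (auto simp: field_simps)
  also have "\<dots> \<longleftrightarrow> dig u = int (m + j)"
    unfolding dig_def by linarith
  also have "\<dots> \<longleftrightarrow> j = nat (dig u) - m" using 2 by auto
  finally show ?thesis .
qed

text \<open>The interval (0, 1] is cut into the sets of constant first digit, and each piece is
  pulled back to [0, 1] along its own branch. The Jacobian and the change of density combine to the
  weight \<open>p j\<close>.\<close>

lemma nn_integral_branches:
  assumes [measurable]: "\<phi> \<in> borel_measurable borel"
  shows "(\<integral>\<^sup>+u. \<phi> u \<partial>M) = (\<integral>\<^sup>+u. (\<Sum>j. ennreal (p j u) * \<phi> (v j u)) \<partial>M)"
proof -
  define h where "h u = ennreal (c / (real m + u))" for u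
  have [measurable]: "h \<in> borel_measurable borel" unfolding h_def by measurable
  \<comment> \<open>The half-open intervals \<open>I j\<close> partition (0, 1] exactly, while the
    substitution is stated for the closed intervals \<open>J j\<close>; they differ by one point, a
    null set.\<close>
  define I where "I j = {real m / real (m + j + 1)<..real m / real (m + j)}" for j
  define J where "J j = {real m / real (m + j + 1)..real m / real (m + j)}" for j
  have [measurable]: "I j \<in> sets borel" "J j \<in> sets borel" for j unfolding I_def J_def by auto
  have h_v: "h (v j u) * ennreal (real m / (real m + real j + u)\<^sup>2) = ennreal (p j u) * h u"
    if "u \<in> {0..1}" for j u
  proof -
    have pos: "real m + real j + u > 0" "real m + u > 0" using that m_pos by auto
    have "c / (real m + v j u) = c * (real m + real j + u) / (real m * (real m + real j + u + 1))"
      using pos m_pos by (simp add: v_def field_simps)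
    then have "c / (real m + v j u) * (real m / (real m + real j + u)\<^sup>2) = p j u * (c / (real m + u))"
      using pos m_pos by (simp add: p_def power2_eq_square)
    then show ?thesis using c_pos pos m_pos v_in[of u j] p_nonneg[of u j] that
      unfolding h_def by (simp flip: ennreal_mult add: ennreal_mult'[symmetric])
  qed
  have "(\<integral>\<^sup>+u. \<phi> u \<partial>M) = (\<integral>\<^sup>+u. \<phi> u * h u * indicator {0..1} u \<partial>lborel)"
    by (simp add: nn_integral_M h_def)
  also have "\<dots> = (\<integral>\<^sup>+u. (\<Sum>j. \<phi> u * h u * indicator (I j) u) \<partial>lborel)"
  proof (rule nn_integral_cong_AE, use AE_lborel_singleton[of "0::real"] in eventually_elim)
    fix u :: real assume "u \<noteq> 0"
    have sub: "I j \<subseteq> {0<..1}" for j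
    proof -
      have "real m / real (m + j) \<le> 1" "0 < real m / real (m + j + 1)"
        using m_pos by (simp_all add: divide_simps)
      then show ?thesis by (auto simp: I_def simp del: of_nat_add)
    qed
    show "\<phi> u * h u * indicator {0..1} u = (\<Sum>j. \<phi> u * h u * indicator (I j) u)"
    proof (cases "u \<in> {0<..1}")
      case True
      then have "indicator (I j) u = (if j = nat (dig u) - m then 1 else 0 :: ennreal)" for j
        using mem_branch_iff_digit[OF True, of j] by (auto simp: I_def indicator_def simp del: of_nat_add)
      then have "(\<lambda>j. \<phi> u * h u * indicator (I j) u) = (\<lambda>j. if j = nat (dig u) - m then \<phi> u * h u else 0)"
        by auto
      then show ?thesis
        using True sums_unique[OF sums_single[of "nat (dig u) - m" "\<lambda>_. \<phi> u * h u"]] by simp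
    next
      case False
      then have "u \<notin> I j" for j using sub by blast
      then show ?thesis using False \<open>u \<noteq> 0\<close> by (auto simp: indicator_def)
    qed
  qed
  also have "\<dots> = (\<Sum>j. \<integral>\<^sup>+u. \<phi> u * h u * indicator (I j) u \<partial>lborel)"
    by (rule nn_integral_suminf) measurable
  also have "\<dots> = (\<Sum>j. \<integral>\<^sup>+u. \<phi> u * h u * indicator (J j) u \<partial>lborel)"
  proof (rule arg_cong[of _ _ suminf], rule ext, rule nn_integral_cong_AE)
    fix j show "AE u in lborel. \<phi> u * h u * indicator (I j) u = \<phi> u * h u * indicator (J j) u"
      using AE_lborel_singleton[of "real m / real (m + j + 1)"]
      by eventually_elim (auto simp: I_def J_def indicator_def)
  qed
  also have "\<dots> = (\<Sum>j. \<integral>\<^sup>+u. (ennreal (p j u) * \<phi> (v j u)) * h u * indicator {0..1} u \<partial>lborel)"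
    unfolding J_def
    by (subst branch_substitution)
       (auto intro!: arg_cong[of _ _ suminf] nn_integral_cong simp: indicator_def mult.assoc h_v
         split: if_splits simp: mult_ac)
  also have "\<dots> = (\<integral>\<^sup>+u. (\<Sum>j. (ennreal (p j u) * \<phi> (v j u)) * h u * indicator {0..1} u) \<partial>lborel)"
    by (rule nn_integral_suminf[symmetric]) measurable
  also have "\<dots> = (\<integral>\<^sup>+u. (\<Sum>j. ennreal (p j u) * \<phi> (v j u)) * h u * indicator {0..1} u \<partial>lborel)"
    by (simp add: ennreal_suminf_multc)
  also have "\<dots> = (\<integral>\<^sup>+u. (\<Sum>j. ennreal (p j u) * \<phi> (v j u)) \<partial>M)"
    by (simp add: nn_integral_M h_def)
  finally show ?thesis .
qed

subsection \<open>The transfer operator\<close>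

text \<open>Taken with respect to \<open>M\<close> rather than Lebesgue measure, so that the
  constant 1 is a fixed point on [0, 1].\<close>

definition transfer_op :: "(real \<Rightarrow> real) \<Rightarrow> real \<Rightarrow> real" where "transfer_op g u = (\<Sum>j. p j u * g (v j u))"

text \<open>The Lipschitz condition is bundled with what nonnegative integrals require:
  \<open>ennreal\<close> would cut negative values to 0, and \<open>M\<close> is a measure on the
  whole Borel line.\<close>

definition nonneg_lipschitz :: "real \<Rightarrow> (real \<Rightarrow> real) \<Rightarrow> bool" where
  "nonneg_lipschitz K g \<longleftrightarrow> g \<in> borel_measurable borel \<and> (\<forall>u\<in>{0..1}. 0 \<le> g u) \<and> K-lipschitz_on {0..1} g"

lemma summable_p:
  assumes "0 \<le> u" "\<And>j. \<bar>f j\<bar> \<le> B"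
  shows "summable (\<lambda>j. p j u * f j)"
proof (rule summable_comparison_test)
  show "summable (\<lambda>j. p j u * B)"
    using sums_summable[OF p_sums_1[OF assms(1)]] by (rule summable_mult2)
  show "\<exists>N. \<forall>j\<ge>N. norm (p j u * f j) \<le> p j u * B"
    using assms p_nonneg by (auto simp: abs_mult intro!: mult_mono)
qed

text \<open>The difference has a closed form whose denominator is smallest at
  \<open>u = w = 0\<close>. The factor \<open>j / (m + j)\<^sup>2\<close> is later estimated by
  \<open>1 / (4 * m)\<close> for the contraction and by \<open>1 / j\<close> for the truncated
  digit.\<close>

lemma tail_diff_le:
  assumes "0 \<le> u" "0 \<le> w"
  shows "\<bar>tail j u - tail j w\<bar> \<le> real j / (real m + real j)\<^sup>2 * \<bar>u - w\<bar>"
proof -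
  have pos: "real m + real j + u > 0" "real m + real j + w > 0" using m_pos assms by auto
  have "tail j u - tail j w = real j * (u - w) / ((real m + real j + u) * (real m + real j + w))"
    using pos unfolding tail_def by (simp add: divide_simps) (simp add: algebra_simps)
  also have "\<bar>\<dots>\<bar> = real j * \<bar>u - w\<bar> / ((real m + real j + u) * (real m + real j + w))"
    using pos by (simp add: abs_mult)
  also have "\<dots> \<le> real j * \<bar>u - w\<bar> / (real m + real j)\<^sup>2"
    unfolding power2_eq_square using m_pos assms by (intro divide_left_mono mult_mono) auto
  finally show ?thesis by simp
qed

text \<open>Summation by parts with \<open>a j = tail j u - tail j w\<close>; the boundary term
  vanishes because \<open>tail 0\<close> is constantly 1. The result involves only the increments of
  \<open>f\<close>, so the size \<open>B\<close> does not enter later estimates.\<close>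

lemma p_diff_sums:
  assumes u: "0 \<le> u" and w: "0 \<le> w" and f: "\<And>j. \<bar>f j\<bar> \<le> B"
  shows "(\<lambda>j. (tail (Suc j) u - tail (Suc j) w) * (f (Suc j) - f j))
    sums ((\<Sum>j. p j u * f j) - (\<Sum>j. p j w * f j))"
proof -
  define a where "a j = tail j u - tail j w" for j
  have 1: "a \<longlonglongrightarrow> 0"
    using tendsto_diff[OF tail_tendsto_0[of u] tail_tendsto_0[of w]] by (simp add: a_def[abs_def])
  have "(\<lambda>j. p j u * f j - p j w * f j) sums ((\<Sum>j. p j u * f j) - (\<Sum>j. p j w * f j))"
    by (intro sums_diff summable_sums summable_p[OF u f] summable_p[OF w f])
  then have "(\<lambda>j. (a j - a (Suc j)) * f j) sums ((\<Sum>j. p j u * f j) - (\<Sum>j. p j w * f j))"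
    using u w by (simp add: p_eq_tail_diff a_def algebra_simps)
  from sums_by_parts[OF 1 BseqI'[of f B] this] f show ?thesis
    using u w m_pos by (simp add: a_def tail_def)
qed

lemma nonneg_lipschitz_le:
  assumes "nonneg_lipschitz K g" "u \<in> {0..1}" "w \<in> {0..1}"
  shows "g u \<le> g w + K"
proof -
  have K: "0 \<le> K" using assms lipschitz_on_nonneg by (auto simp: nonneg_lipschitz_def)
  have "dist (g u) (g w) \<le> K * dist u w"
    using assms lipschitz_onD[of K "{0..1}" g u w] by (auto simp: nonneg_lipschitz_def)
  also have "\<dots> \<le> K * 1" using assms K by (intro mult_left_mono) (auto simp: dist_real_def)
  finally show ?thesis by (auto simp: dist_real_def)
qed

lemma nonneg_lipschitz_bounded:
  assumes "nonneg_lipschitz K g" "u \<in> {0..1}"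
  shows "\<bar>g u\<bar> \<le> g 0 + K"
  using nonneg_lipschitz_le[OF assms, of 0] assms by (auto simp: nonneg_lipschitz_def)

lemma v_in_Icc: "u \<in> {0..1} \<Longrightarrow> v j u \<in> {0..1}"
  using v_in[of u j] by auto

text \<open>The branches contract by \<open>1 / m\<close>; the dependence of the weights on \<open>u\<close>, estimated by summation by
  parts and \<open>4 m i \<le> (m + i)\<^sup>2\<close>, contributes \<open>1 / (4 m)\<close>. For \<open>m \<ge> 2\<close> the total is at most \<open>5/8\<close>.\<close>

lemma transfer_op_contracts:
  assumes g: "nonneg_lipschitz K g"
  shows "nonneg_lipschitz (5/8 * K) (transfer_op g)"
proof -
  have K: "0 \<le> K" using g lipschitz_on_nonneg by (auto simp: nonneg_lipschitz_def)
  have [measurable]: "g \<in> borel_measurable borel" using g by (auto simp: nonneg_lipschitz_def)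
  have lip: "\<bar>g x - g y\<bar> \<le> K * \<bar>x - y\<bar>" if "x \<in> {0..1}" "y \<in> {0..1}" for x y
    using g that lipschitz_onD[of K "{0..1}" g x y] by (auto simp: nonneg_lipschitz_def dist_real_def)
  have bd: "\<bar>g (v j u)\<bar> \<le> g 0 + K" if "u \<in> {0..1}" for j u
    by (intro nonneg_lipschitz_bounded[OF g] v_in_Icc that)
  have meas: "transfer_op g \<in> borel_measurable borel"
    unfolding transfer_op_def by measurable
  have nonneg: "0 \<le> transfer_op g u" if "u \<in> {0..1}" for u
    unfolding transfer_op_def using that g v_in_Icc[OF that] p_nonneg
    by (intro suminf_nonneg summable_p[OF _ bd[OF that]]) (auto simp: nonneg_lipschitz_def)
  have lipP: "\<bar>transfer_op g u - transfer_op g w\<bar> \<le> 5/8 * K * \<bar>u - w\<bar>" if u: "u \<in> {0..1}" and w: "w \<in> {0..1}" for u w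
  proof -
    have u0: "0 \<le> u" and w0: "0 \<le> w" using u w by auto
    \<comment> \<open>Intermediate value with weights at \<open>u\<close> and branch points over
      \<open>w\<close>: one half of the comparison moves only the branch points, the other only the
      weights.\<close>
    define R where "R = (\<Sum>j. p j u * g (v j w))"
    have "(\<lambda>j. p j u * g (v j u) - p j u * g (v j w)) sums (transfer_op g u - R)"
      unfolding transfer_op_def R_def
      by (intro sums_diff summable_sums summable_p[OF u0 bd[OF u]] summable_p[OF u0 bd[OF w]])
    moreover have "(\<lambda>j. p j u * (K * \<bar>u - w\<bar> / real m)) sums (1 * (K * \<bar>u - w\<bar> / real m))"
      by (intro sums_mult2 p_sums_1 u0)
    moreover have "norm (p j u * g (v j u) - p j u * g (v j w)) \<le> p j u * (K * \<bar>u - w\<bar> / real m)" for j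
    proof -
      have pos: "real m + real j + u > 0" "real m + real j + w > 0" using m_pos u0 w0 by auto
      have "v j u - v j w = real m * (w - u) / ((real m + real j + u) * (real m + real j + w))"
        unfolding v_def using pos by (simp add: divide_simps) (simp add: algebra_simps)
      also have "\<bar>\<dots>\<bar> = real m * \<bar>u - w\<bar> / ((real m + real j + u) * (real m + real j + w))"
        using pos by (simp add: abs_mult abs_minus_commute)
      also have "\<dots> \<le> real m * \<bar>u - w\<bar> / (real m * real m)"
        using m_pos u0 w0 by (intro divide_left_mono mult_mono) auto
      also have "\<dots> = \<bar>u - w\<bar> / real m" using m_pos by simp
      finally have "\<bar>g (v j u) - g (v j w)\<bar> \<le> K * (\<bar>u - w\<bar> / real m)"
        using lip[OF v_in_Icc[OF u] v_in_Icc[OF w], of j j] K by (meson mult_left_mono order_trans)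
      then show ?thesis
        using mult_left_mono[OF _ p_nonneg[OF u0, of j], of "\<bar>g (v j u) - g (v j w)\<bar>" "K * (\<bar>u - w\<bar> / real m)"]
          p_nonneg[OF u0, of j]
        by (simp flip: right_diff_distrib add: abs_mult)
    qed
    ultimately have 1: "\<bar>transfer_op g u - R\<bar> \<le> K * \<bar>u - w\<bar> / real m"
      using norm_sums_le by fastforce
    have "(\<lambda>j. (tail (Suc j) u - tail (Suc j) w) * (g (v (Suc j) w) - g (v j w))) sums (R - transfer_op g w)"
      unfolding transfer_op_def R_def by (rule p_diff_sums[OF u0 w0 bd[OF w]])
    \<comment> \<open>With \<open>s = m + j + 1\<close>, consecutive branch points differ by at most
      \<open>m / ((s - 1) * s)\<close>, that is \<open>m * (1 / (s - 1) - 1 / s)\<close>; this gives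
      a telescoping majorant with total proportional to \<open>1 / m\<close>.\<close>
    moreover have "(\<lambda>j. K * \<bar>u - w\<bar> / 4 * (1 / (real m + real j) - 1 / (real m + real (Suc j))))
        sums (K * \<bar>u - w\<bar> / 4 * (1 / (real m + real 0) - 0))"
      by (intro sums_mult telescope_sums') real_asymp
    moreover have "norm ((tail (Suc j) u - tail (Suc j) w) * (g (v (Suc j) w) - g (v j w)))
        \<le> K * \<bar>u - w\<bar> / 4 * (1 / (real m + real j) - 1 / (real m + real (Suc j)))" for j
    proof -
      define i where "i = real (Suc j)"
      define s where "s = real m + i"
      have i: "i \<ge> 1" "real j = i - 1" by (simp_all add: i_def)
      have s: "s > 1" using i m_pos by (simp add: s_def)
      have "4 * (real m * i) \<le> s\<^sup>2"
        using sum_squares_bound[of "real m" i] unfolding s_def by (simp add: power2_sum mult_ac)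
      then have "real m * i / s\<^sup>2 \<le> 1 / 4"
        using s by (simp add: divide_simps)
      have "v j w - v (Suc j) w = real m / ((s - 1 + w) * (s + w))"
        using s w0 by (simp add: v_def s_def i field_simps flip: i_def)
      also have "\<bar>\<dots>\<bar> \<le> real m / ((s - 1) * s)"
        using s w0 m_pos by (auto simp: abs_mult intro!: divide_left_mono mult_mono)
      finally have gv: "\<bar>g (v (Suc j) w) - g (v j w)\<bar> \<le> K * (real m / ((s - 1) * s))"
        using lip[OF v_in_Icc[OF w] v_in_Icc[OF w], of "Suc j" j] K
        by (smt (verit, best) mult_left_mono abs_minus_commute)
      have "\<bar>tail (Suc j) u - tail (Suc j) w\<bar> \<le> i / s\<^sup>2 * \<bar>u - w\<bar>"
        using tail_diff_le[OF u0 w0, of "Suc j"] by (simp only: s_def i_def)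
      then have "norm ((tail (Suc j) u - tail (Suc j) w) * (g (v (Suc j) w) - g (v j w)))
          \<le> (i / s\<^sup>2 * \<bar>u - w\<bar>) * (K * (real m / ((s - 1) * s)))"
        unfolding real_norm_def abs_mult using gv i by (intro mult_mono) auto
      also have "\<dots> = (real m * i / s\<^sup>2) * (K * \<bar>u - w\<bar> / ((s - 1) * s))"
        using s by simp
      also have "\<dots> \<le> 1/4 * (K * \<bar>u - w\<bar> / ((s - 1) * s))"
        using K s \<open>real m * i / s\<^sup>2 \<le> 1 / 4\<close> by (intro mult_right_mono) auto
      also have "\<dots> = K * \<bar>u - w\<bar> / 4 * (1 / (s - 1) - 1 / s)"
        using s by (simp add: field_simps)
      finally show ?thesis by (simp add: s_def i add_diff_eq flip: i_def)
    qed
    ultimately have 2: "\<bar>R - transfer_op g w\<bar> \<le> K * \<bar>u - w\<bar> / 4 * (1 / real m)"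
      using norm_sums_le by fastforce
    have "\<bar>transfer_op g u - transfer_op g w\<bar> \<le> 5/4 * (K * \<bar>u - w\<bar>) * (1 / real m)"
      using 1 2 by (simp add: field_simps)
    also have "\<dots> \<le> 5/4 * (K * \<bar>u - w\<bar>) * (1 / 2)"
      using m_ge K by (intro mult_left_mono) (auto simp: field_simps)
    finally show ?thesis by simp
  qed
  show ?thesis
    unfolding nonneg_lipschitz_def
    using meas nonneg lipP K by (auto intro!: lipschitz_onI simp: dist_real_def)
qed

section \<open>Duality with composition by the map, and invariance of the measure\<close>

lemma transfer_op_duality:
  assumes [measurable]: "g \<in> borel_measurable borel" and g: "\<And>u. u \<in> {0<..1} \<Longrightarrow> 0 \<le> g u \<and> g u \<le> C"
    and [measurable]: "\<phi> \<in> borel_measurable borel"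
  shows "(\<integral>\<^sup>+u. ennreal (g u) * \<phi> (T u) \<partial>M) = (\<integral>\<^sup>+u. ennreal (transfer_op g u) * \<phi> u \<partial>M)"
proof -
  have "(\<integral>\<^sup>+u. ennreal (g u) * \<phi> (T u) \<partial>M) =
      (\<integral>\<^sup>+u. (\<Sum>j. ennreal (p j u) * (ennreal (g (v j u)) * \<phi> (T (v j u)))) \<partial>M)"
    by (rule nn_integral_branches) measurable
  also have "\<dots> = (\<integral>\<^sup>+u. ennreal (transfer_op g u) * \<phi> u \<partial>M)"
  proof (rule nn_integral_cong_AE, use AE_M in eventually_elim)
    fix u :: real assume u: "u \<in> {0<..<1}"
    have gv: "0 \<le> g (v j u)" "\<bar>g (v j u)\<bar> \<le> C" for j
      using g[OF v_in[of u j]] u by auto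
    have "(\<Sum>j. ennreal (p j u) * (ennreal (g (v j u)) * \<phi> (T (v j u)))) =
        (\<Sum>j. ennreal (p j u * g (v j u)) * \<phi> u)"
      using u p_nonneg[of u] by (simp add: T_v ennreal_mult' mult.assoc)
    also have "\<dots> = (\<Sum>j. ennreal (p j u * g (v j u))) * \<phi> u" by simp
    also have "(\<Sum>j. ennreal (p j u * g (v j u))) = ennreal (transfer_op g u)"
      unfolding transfer_op_def using u p_nonneg[of u] gv
      by (intro suminf_ennreal2 summable_p[of u _ C]) auto
    finally show "(\<Sum>j. ennreal (p j u) * (ennreal (g (v j u)) * \<phi> (T (v j u)))) = ennreal (transfer_op g u) * \<phi> u" .
  qed
  finally show ?thesis .
qed

lemma transfer_op_funpow_duality:
  assumes "nonneg_lipschitz K g" and [measurable]: "\<phi> \<in> borel_measurable borel"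
  shows "(\<integral>\<^sup>+u. ennreal (g u) * \<phi> ((T ^^ d) u) \<partial>M) = (\<integral>\<^sup>+u. ennreal ((transfer_op ^^ d) g u) * \<phi> u \<partial>M)"
  using assms(1)
proof (induction d arbitrary: K g)
  case (Suc d)
  have "(\<lambda>u. \<phi> ((T ^^ d) u)) \<in> borel_measurable borel" by measurable
  from transfer_op_duality[of g "g 0 + K", OF _ _ this] nonneg_lipschitz_bounded[OF Suc.prems] Suc.prems
    Suc.IH[OF transfer_op_contracts[OF Suc.prems]]
  show ?case by (fastforce simp: funpow_swap1 nonneg_lipschitz_def)
qed simp

lemma transfer_op_funpow_contracts:
  "nonneg_lipschitz K g \<Longrightarrow> nonneg_lipschitz ((5/8) ^ d * K) ((transfer_op ^^ d) g)"
  by (induction d) (auto dest: transfer_op_contracts simp: mult.assoc)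

lemma T_invariant:
  assumes [measurable]: "\<phi> \<in> borel_measurable borel"
  shows "(\<integral>\<^sup>+u. \<phi> ((T ^^ d) u) \<partial>M) = (\<integral>\<^sup>+u. \<phi> u \<partial>M)"
proof (induction d)
  case (Suc d)
  have "(\<integral>\<^sup>+u. \<phi> ((T ^^ Suc d) u) \<partial>M) = (\<integral>\<^sup>+u. \<phi> ((T ^^ d) (T u)) \<partial>M)"
    by (simp add: funpow_swap1)
  \<comment> \<open>Invariance is duality for \<open>g = 1\<close>, which the operator fixes almost
    everywhere.\<close>
  also have "\<dots> = (\<integral>\<^sup>+u. ennreal (transfer_op (\<lambda>_. 1) u) * \<phi> ((T ^^ d) u) \<partial>M)"
    using transfer_op_duality[of "\<lambda>_. 1" 1 "\<lambda>u. \<phi> ((T ^^ d) u)"] by simp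
  also have "\<dots> = (\<integral>\<^sup>+u. \<phi> ((T ^^ d) u) \<partial>M)"
    using AE_M by (intro nn_integral_cong_AE)
      (auto elim!: eventually_mono simp: transfer_op_def sums_unique[OF p_sums_1, symmetric])
  finally show ?case using Suc by simp
qed simp

subsection \<open>Truncated digits\<close>

text \<open>Large digits are capped at \<open>B\<close> rather than replaced by 0, so that passing
  to the next digit changes the value by at most 1.\<close>

definition trunc_digit :: "nat \<Rightarrow> real \<Rightarrow> real" where "trunc_digit B u = real (min (nat (dig u)) B)"

lemma trunc_digit_measurable [measurable]: "trunc_digit B \<in> borel_measurable borel"
  unfolding trunc_digit_def by measurable

lemma trunc_digit_bounds: "0 \<le> trunc_digit B u" "trunc_digit B u \<le> real B"
  by (auto simp: trunc_digit_def)

text \<open>The truncated digit is a step function, but one application of the operator smooths it: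
  only the weights then depend on \<open>u\<close>. After summation by parts the increments are at
  most 1 and vanish for \<open>j \<ge> B\<close>, which leaves a harmonic sum.\<close>

lemma lipschitz_transfer_trunc_digit: "nonneg_lipschitz (harm B) (\<lambda>u. \<Sum>j. p j u * real (min (m + j) B))"
proof -
  have bd: "\<bar>real (min (m + j) B)\<bar> \<le> real B" for j by simp
  have lip: "\<bar>(\<Sum>j. p j u * real (min (m + j) B)) - (\<Sum>j. p j w * real (min (m + j) B))\<bar> \<le> harm B * \<bar>u - w\<bar>"
    if u: "0 \<le> u" and w: "0 \<le> w" for u w
  proof -
    have "(\<lambda>j. (tail (Suc j) u - tail (Suc j) w) * (real (min (m + Suc j) B) - real (min (m + j) B)))
      sums ((\<Sum>j. p j u * real (min (m + j) B)) - (\<Sum>j. p j w * real (min (m + j) B)))"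
      by (rule p_diff_sums[OF u w bd])
    moreover have "(\<lambda>j. if j \<in> {..<B} then \<bar>u - w\<bar> / real (Suc j) else 0) sums (\<Sum>j<B. \<bar>u - w\<bar> / real (Suc j))"
      by (intro sums_If_finite_set) auto
    moreover have "norm ((tail (Suc j) u - tail (Suc j) w) * (real (min (m + Suc j) B) - real (min (m + j) B)))
        \<le> (if j \<in> {..<B} then \<bar>u - w\<bar> / real (Suc j) else 0)" for j
    proof (cases "j < B")
      case True
      have "real (Suc j) / (real m + real (Suc j))\<^sup>2 \<le> real (Suc j) / (real (Suc j))\<^sup>2"
        using m_pos by (intro divide_left_mono power_mono mult_pos_pos zero_less_power) (auto simp: add_pos_pos)
      also have "\<dots> = 1 / real (Suc j)" by (simp add: power2_eq_square)
      finally have "\<bar>tail (Suc j) u - tail (Suc j) w\<bar> \<le> 1 / real (Suc j) * \<bar>u - w\<bar>"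
        using tail_diff_le[OF u w, of "Suc j"] by (meson abs_ge_zero mult_right_mono order_trans)
      then have "\<bar>tail (Suc j) u - tail (Suc j) w\<bar> * \<bar>real (min (m + Suc j) B) - real (min (m + j) B)\<bar>
          \<le> (1 / real (Suc j) * \<bar>u - w\<bar>) * 1"
        by (intro mult_mono) auto
      then show ?thesis using True by (simp add: abs_mult)
    qed auto
    ultimately have "\<bar>(\<Sum>j. p j u * real (min (m + j) B)) - (\<Sum>j. p j w * real (min (m + j) B))\<bar>
        \<le> (\<Sum>j<B. \<bar>u - w\<bar> / real (Suc j))"
      using norm_sums_le by fastforce
    also have "\<dots> = harm B * \<bar>u - w\<bar>"
      unfolding harm_def sum_distrib_right
      by (rule sum.reindex_bij_witness[of _ "\<lambda>k. k - 1" Suc]) (auto simp: divide_inverse mult.commute)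
    finally show ?thesis .
  qed
  show ?thesis
    unfolding nonneg_lipschitz_def
  proof (intro conjI ballI lipschitz_onI)
    fix u :: real assume "u \<in> {0..1}"
    then show "0 \<le> (\<Sum>j. p j u * real (min (m + j) B))"
      by (intro suminf_nonneg summable_p[OF _ bd] mult_nonneg_nonneg p_nonneg) auto
  next
    fix u w :: real assume "u \<in> {0..1}" "w \<in> {0..1}"
    then show "dist (\<Sum>j. p j u * real (min (m + j) B)) (\<Sum>j. p j w * real (min (m + j) B)) \<le> harm B * dist u w"
      unfolding dist_real_def by (intro lip) auto
  qed (measurable, simp add: harm_nonneg)
qed

lemma transfer_op_trunc_digit: assumes "u \<in> {0..<1}" shows "transfer_op (trunc_digit B) u = (\<Sum>j. p j u * real (min (m + j) B))"
  unfolding transfer_op_def trunc_digit_def using assms by (simp add: dig_v nat_int_add)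

text \<open>The inequality \<open>g u \<le> g w + K\<close> is averaged over \<open>w\<close>. A
  small Lipschitz constant thus keeps \<open>g\<close> close to its mean from above.\<close>

lemma nonneg_lipschitz_le_integral:
  assumes g: "nonneg_lipschitz K g" and a: "(\<integral>\<^sup>+u. ennreal (g u) \<partial>M) = ennreal a" "0 \<le> a" and u: "u \<in> {0..1}"
  shows "g u \<le> a + K"
proof -
  have [measurable]: "g \<in> borel_measurable borel" and K: "0 \<le> K"
    using g lipschitz_on_nonneg by (auto simp: nonneg_lipschitz_def)
  have "ennreal (g u) = (\<integral>\<^sup>+w. ennreal (g u) \<partial>M)"
    by (simp add: emeasure_space_1)
  also have "\<dots> \<le> (\<integral>\<^sup>+w. ennreal (g w) + ennreal K \<partial>M)"
  proof (rule nn_integral_mono_AE, use AE_M in eventually_elim)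
    fix w :: real assume "w \<in> {0<..<1}"
    then have w: "w \<in> {0..1}" by auto
    then have "0 \<le> g w" using g by (auto simp: nonneg_lipschitz_def)
    then show "ennreal (g u) \<le> ennreal (g w) + ennreal K"
      using nonneg_lipschitz_le[OF g u w] K by (simp flip: ennreal_plus)
  qed
  also have "\<dots> = ennreal (a + K)"
    using a K by (subst nn_integral_add) (auto simp: emeasure_space_1)
  finally show ?thesis using a K by (subst (asm) ennreal_le_iff) auto
qed

section \<open>Mean and correlations of the truncated digits\<close>

definition mu :: "nat \<Rightarrow> real" where "mu B = expectation (trunc_digit B)"

lemma integrable_trunc_digit: "integrable M (\<lambda>u. trunc_digit B ((T ^^ k) u))"
  by (rule integrable_const_bound[of _ "real B"]) (auto simp: trunc_digit_bounds)

lemma integrable_trunc_digit_mult: "integrable M (\<lambda>u. trunc_digit B ((T ^^ j) u) * trunc_digit B ((T ^^ k) u))"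
  by (rule integrable_const_bound[of _ "real B * real B"])
     (auto simp: trunc_digit_bounds abs_mult intro!: mult_mono)

lemma mu_nonneg: "0 \<le> mu B"
  unfolding mu_def by (intro Bochner_Integration.integral_nonneg trunc_digit_bounds)

lemma nn_integral_trunc_digit: "(\<integral>\<^sup>+u. ennreal (trunc_digit B u) \<partial>M) = ennreal (mu B)"
  unfolding mu_def using integrable_trunc_digit[of B 0] by (intro nn_integral_eq_integral) (auto simp: trunc_digit_bounds)

lemma expectation_invariant:
  fixes f :: "real \<Rightarrow> real"
  assumes [measurable]: "f \<in> borel_measurable borel" and f: "\<And>u. 0 \<le> f u"
  shows "expectation (\<lambda>u. f ((T ^^ k) u)) = expectation f"
  using T_invariant[of "\<lambda>u. ennreal (f u)" k] f
  by (simp add: integral_eq_nn_integral)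

lemma expectation_sum_trunc_digit: "expectation (\<lambda>u. \<Sum>k<n. trunc_digit B ((T ^^ k) u)) = real n * mu B"
  using expectation_invariant[of "trunc_digit B"]
  by (simp add: integrable_trunc_digit trunc_digit_bounds mu_def)

text \<open>Of the \<open>d + 1\<close> time steps, the first turns the digit into the Lipschitz
  function \<open>G\<close>, and the other \<open>d\<close> shrink its constant by
  \<open>(5/8) ^ d\<close>. The result \<open>H\<close> keeps the mean \<open>mu B\<close>, hence is
  pointwise at most \<open>mu B\<close> plus its Lipschitz constant. An upper bound suffices for the
  variance.\<close>

lemma trunc_digit_correlation:
  "expectation (\<lambda>u. trunc_digit B u * trunc_digit B ((T ^^ Suc d) u)) \<le> (mu B + (5/8) ^ d * harm B) * mu B"
proof -
  define G where "G = (\<lambda>u. \<Sum>j. p j u * real (min (m + j) B))"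
  have G: "nonneg_lipschitz (harm B) G" unfolding G_def by (rule lipschitz_transfer_trunc_digit)
  have [measurable]: "G \<in> borel_measurable borel" using G by (auto simp: nonneg_lipschitz_def)
  have G_dual: "(\<integral>\<^sup>+u. ennreal (trunc_digit B u) * \<phi> (T u) \<partial>M) = (\<integral>\<^sup>+u. ennreal (G u) * \<phi> u \<partial>M)"
    if [measurable]: "\<phi> \<in> borel_measurable borel" for \<phi>
  proof -
    have "(\<integral>\<^sup>+u. ennreal (trunc_digit B u) * \<phi> (T u) \<partial>M) = (\<integral>\<^sup>+u. ennreal (transfer_op (trunc_digit B) u) * \<phi> u \<partial>M)"
      by (rule transfer_op_duality[of _ "real B"]) (auto simp: trunc_digit_bounds)
    also have "\<dots> = (\<integral>\<^sup>+u. ennreal (G u) * \<phi> u \<partial>M)"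
      by (intro nn_integral_cong_AE eventually_mono[OF AE_M]) (auto simp: transfer_op_trunc_digit G_def)
    finally show ?thesis .
  qed
  define H where "H = (transfer_op ^^ d) G"
  have H: "nonneg_lipschitz ((5/8) ^ d * harm B) H"
    unfolding H_def by (rule transfer_op_funpow_contracts[OF G])
  have [measurable]: "H \<in> borel_measurable borel" using H by (auto simp: nonneg_lipschitz_def)
  have H_int: "(\<integral>\<^sup>+u. ennreal (H u) \<partial>M) = ennreal (mu B)"
    using transfer_op_funpow_duality[OF G, of "\<lambda>_. 1" d] G_dual[of "\<lambda>_. 1"] nn_integral_trunc_digit[of B] by (simp add: H_def)
  have nonneg: "0 \<le> mu B + (5/8) ^ d * harm B"
    using mu_nonneg by (simp add: harm_nonneg)
  have "(\<integral>\<^sup>+u. ennreal (trunc_digit B u * trunc_digit B ((T ^^ Suc d) u)) \<partial>M) =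
      (\<integral>\<^sup>+u. ennreal (trunc_digit B u) * ennreal (trunc_digit B ((T ^^ d) (T u))) \<partial>M)"
    by (simp add: ennreal_mult trunc_digit_bounds funpow_swap1)
  also have "\<dots> = (\<integral>\<^sup>+u. ennreal (G u) * ennreal (trunc_digit B ((T ^^ d) u)) \<partial>M)"
    by (rule G_dual) measurable
  also have "\<dots> = (\<integral>\<^sup>+u. ennreal (H u) * ennreal (trunc_digit B u) \<partial>M)"
    unfolding H_def by (rule transfer_op_funpow_duality[OF G]) measurable
  also have "\<dots> \<le> (\<integral>\<^sup>+u. ennreal (mu B + (5/8) ^ d * harm B) * ennreal (trunc_digit B u) \<partial>M)"
    using nonneg_lipschitz_le_integral[OF H H_int mu_nonneg]
    by (intro nn_integral_mono_AE eventually_mono[OF AE_M]) (auto intro!: mult_right_mono ennreal_leI)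
  also have "\<dots> = ennreal ((mu B + (5/8) ^ d * harm B) * mu B)"
    using nonneg mu_nonneg by (simp add: nn_integral_cmult nn_integral_trunc_digit ennreal_mult)
  finally have "(\<integral>\<^sup>+u. ennreal (trunc_digit B u * trunc_digit B ((T ^^ Suc d) u)) \<partial>M) \<le> ennreal ((mu B + (5/8) ^ d * harm B) * mu B)" .
  moreover have "(\<integral>\<^sup>+u. ennreal (trunc_digit B u * trunc_digit B ((T ^^ Suc d) u)) \<partial>M) =
      ennreal (expectation (\<lambda>u. trunc_digit B u * trunc_digit B ((T ^^ Suc d) u)))"
    using integrable_trunc_digit_mult[of B 0 "Suc d"] by (intro nn_integral_eq_integral) (auto simp: trunc_digit_bounds)
  ultimately show ?thesis
    using nonneg mu_nonneg by (simp add: ennreal_le_iff)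
qed

section \<open>Tail of the first digit and moments of the truncated digit\<close>

definition digit_ge_prob :: "nat \<Rightarrow> real" where "digit_ge_prob k = prob {u. k \<le> nat (dig u)}"

lemma digit_ge_iff: assumes "0 < u" "1 \<le> k" shows "k \<le> nat (dig u) \<longleftrightarrow> u \<le> real m / real k"
proof -
  have "k \<le> nat (dig u) \<longleftrightarrow> real k \<le> real m / u"
    using assms unfolding dig_def by (simp add: le_nat_iff le_floor_iff)
  also have "\<dots> \<longleftrightarrow> u \<le> real m / real k" using assms by (simp add: field_simps)
  finally show ?thesis .
qed

lemma digit_ge_prob_eq_1: assumes "1 \<le> k" "k \<le> m" shows "digit_ge_prob k = 1"
proof -
  have "1 \<le> real m / real k" using assms by simp
  then have "u \<le> real m / real k" if "u \<in> {0<..<1}" for u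
    using that by (metis greaterThanLessThan_iff less_le order_trans)
  then have "AE u in M. k \<le> nat (dig u)"
    using assms by (intro eventually_mono[OF AE_M]) (auto simp: digit_ge_iff)
  then show ?thesis unfolding digit_ge_prob_def
    by (subst prob_eq_1) (auto simp: sets_M)
qed

lemma digit_ge_prob_eq: assumes "m \<le> k" shows "digit_ge_prob k = c * ln (1 + 1 / real k)"
proof -
  have k: "1 \<le> k" using assms m_ge_2 by simp
  have le: "real m / real k \<le> 1" using assms k by simp
  have meas: "{u. k \<le> nat (dig u)} \<in> sets borel" by measurable
  have "emeasure M {u. k \<le> nat (dig u)} = emeasure M {0..real m / real k}"
    using meas k by (intro emeasure_eq_AE eventually_mono[OF AE_M]) (auto simp: digit_ge_iff sets_M)
  also have "\<dots> = ennreal (c * ln (1 + 1 / real k))"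
    using le m_pos by (subst emeasure_M_Icc) auto
  finally show ?thesis
    unfolding digit_ge_prob_def measure_def using c_pos by simp
qed

lemma digit_ge_prob_le: assumes "1 \<le> k" shows "digit_ge_prob k \<le> c / real k"
proof (cases "m \<le> k")
  case True
  have "c * ln (1 + 1 / real k) \<le> c * (1 / real k)"
    using c_pos by (intro mult_left_mono ln_add_one_self_le_self) auto
  then show ?thesis using digit_ge_prob_eq[OF True] by simp
next
  case False
  \<comment> \<open>Below \<open>m\<close> the probability is 1, and the bound still holds since
    \<open>k < m \<le> c\<close>.\<close>
  have "real m \<le> c"
    using ln_add_one_self_le_self[of "1 / real m"] ln_m_pos m_pos
    unfolding c_def by (simp add: field_simps)
  then show ?thesis using False assms digit_ge_prob_eq_1[of k] by (simp add: field_simps)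
qed

lemma trunc_digit_eq_sum: "trunc_digit B u = (\<Sum>k=1..B. indicator {u. k \<le> nat (dig u)} u)"
proof -
  have "(\<Sum>k=1..B. indicator {u. k \<le> nat (dig u)} u :: real) = (\<Sum>k\<in>{1..min (nat (dig u)) B}. 1)"
    by (intro sum.mono_neutral_cong_right) (auto simp: indicator_def)
  then show ?thesis by (simp add: trunc_digit_def)
qed

text \<open>Layer decomposition of the square, using that \<open>2 * k\<close> sums to
  \<open>n\<^sup>2 + n\<close>. Against the tail bound \<open>c / k\<close> every layer contributes
  at most \<open>2 * c\<close>, so the second moment is linear in \<open>B\<close>.\<close>

lemma trunc_digit_sq_le_sum: "(trunc_digit B u)\<^sup>2 \<le> (\<Sum>k=1..B. 2 * real k * indicator {u. k \<le> nat (dig u)} u)"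
proof -
  have "(\<Sum>k=1..n. 2 * real k) = (real n)\<^sup>2 + real n" for n
    by (induction n) (auto simp: power2_eq_square algebra_simps)
  moreover have "(\<Sum>k=1..B. 2 * real k * indicator {u. k \<le> nat (dig u)} u :: real) = (\<Sum>k\<in>{1..min (nat (dig u)) B}. 2 * real k)"
    by (intro sum.mono_neutral_cong_right) (auto simp: indicator_def)
  ultimately show ?thesis by (simp add: trunc_digit_def)
qed

lemma integrable_digit_ge: "integrable M (indicator {u. k \<le> nat (dig u)} :: real \<Rightarrow> real)"
proof (rule integrable_real_indicator)
  show "{u. k \<le> nat (dig u)} \<in> sets M" unfolding sets_M by measurable
qed (simp add: less_top[symmetric])

lemma mu_eq_sum: "mu B = (\<Sum>k=1..B. digit_ge_prob k)"
proof -
  have "mu B = (\<Sum>k=1..B. expectation (indicator {u. k \<le> nat (dig u)}))"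
    unfolding mu_def trunc_digit_eq_sum
    by (intro Bochner_Integration.integral_sum integrable_digit_ge)
  then show ?thesis by (simp add: digit_ge_prob_def space_M)
qed

text \<open>The layers up to \<open>m\<close> have probability 1; the later ones are
  \<open>c * ln ((k + 1) / k)\<close> and telescope.\<close>

lemma mu_eq: assumes "m \<le> B" shows "mu B = real m + c * (ln (real (B + 1)) - ln (real (m + 1)))"
  using assms
proof (induction B rule: dec_induct)
  case base
  have "mu m = (\<Sum>k=1..m. 1)"
    unfolding mu_eq_sum by (intro sum.cong) (auto simp: digit_ge_prob_eq_1)
  then show ?case by simp
next
  case (step n)
  have "mu (Suc n) = mu n + digit_ge_prob (Suc n)" by (simp add: mu_eq_sum)
  also have "digit_ge_prob (Suc n) = c * ln (real (Suc n + 1) / real (n + 1))"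
    using step by (subst digit_ge_prob_eq) (auto simp: field_simps)
  also have "\<dots> = c * (ln (real (Suc n + 1)) - ln (real (n + 1)))"
    by (subst ln_div) auto
  finally show ?case using step by (simp add: algebra_simps)
qed

lemma trunc_digit_second_moment: "expectation (\<lambda>u. (trunc_digit B u)\<^sup>2) \<le> 2 * c * real B"
proof -
  have int: "integrable M (\<lambda>u. (trunc_digit B u)\<^sup>2)"
    using integrable_trunc_digit_mult[of B 0 0] by (simp add: power2_eq_square)
  have "expectation (\<lambda>u. (trunc_digit B u)\<^sup>2) \<le> expectation (\<lambda>u. \<Sum>k=1..B. 2 * real k * indicator {u. k \<le> nat (dig u)} u)"
    by (intro integral_mono int trunc_digit_sq_le_sum Bochner_Integration.integrable_sum integrable_mult_right integrable_digit_ge)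
  also have "\<dots> = (\<Sum>k=1..B. expectation (\<lambda>u. 2 * real k * indicator {u. k \<le> nat (dig u)} u))"
    by (intro Bochner_Integration.integral_sum integrable_mult_right integrable_digit_ge)
  also have "\<dots> = (\<Sum>k=1..B. 2 * real k * digit_ge_prob k)"
    by (simp add: digit_ge_prob_def space_M)
  also have "\<dots> \<le> (\<Sum>k=1..B. 2 * c)"
  proof (rule sum_mono)
    fix k assume "k \<in> {1..B}"
    then show "2 * real k * digit_ge_prob k \<le> 2 * c" using digit_ge_prob_le[of k] by (simp add: field_simps)
  qed
  finally show ?thesis by (simp add: mult.commute)
qed

section \<open>Variance of the truncated sums and the deviation bound\<close>

lemma trunc_digit_covariance:
  "expectation (\<lambda>u. trunc_digit B ((T ^^ j) u) * trunc_digit B ((T ^^ k) u)) - (mu B)\<^sup>2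
   \<le> (8/5 * harm B * mu B) * (5/8) ^ nat \<bar>int j - int k\<bar> + (if j = k then 2 * c * real B else 0)"
proof (induction j k rule: linorder_wlog)
  case (le j k)
  show ?case
  proof (cases "j = k")
    case True
    have "expectation (\<lambda>u. trunc_digit B ((T ^^ j) u) * trunc_digit B ((T ^^ j) u)) \<le> 2 * c * real B"
      using trunc_digit_second_moment[of B] expectation_invariant[of "\<lambda>u. (trunc_digit B u)\<^sup>2" j]
      by (simp add: power2_eq_square)
    moreover have "0 \<le> 8/5 * harm B * mu B" using mu_nonneg by (simp add: harm_nonneg)
    moreover have "0 \<le> (mu B)\<^sup>2" by simp
    ultimately have "expectation (\<lambda>u. trunc_digit B ((T ^^ j) u) * trunc_digit B ((T ^^ j) u)) - (mu B)\<^sup>2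
        \<le> 8/5 * harm B * mu B + 2 * c * real B"
      by linarith
    then show ?thesis using True by simp
  next
    case False
    then obtain d where k: "k = Suc d + j" using le by (metis less_imp_Suc_add add.commute le_neq_implies_less add_Suc_right)
    have "(T ^^ k) u = (T ^^ Suc d) ((T ^^ j) u)" for u
      by (simp only: k funpow_add o_apply)
    then have "expectation (\<lambda>u. trunc_digit B ((T ^^ j) u) * trunc_digit B ((T ^^ k) u)) =
        expectation (\<lambda>u. trunc_digit B ((T ^^ j) u) * trunc_digit B ((T ^^ Suc d) ((T ^^ j) u)))"
      by presburger
    also have "\<dots> = expectation (\<lambda>u. trunc_digit B u * trunc_digit B ((T ^^ Suc d) u))"
      by (rule expectation_invariant) (measurable, intro mult_nonneg_nonneg trunc_digit_bounds)
    also have "\<dots> \<le> (mu B + (5/8) ^ d * harm B) * mu B" by (rule trunc_digit_correlation)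
    \<comment> \<open>The decay has exponent \<open>d\<close> while the time distance is
      \<open>d + 1\<close>; the factor \<open>8/5\<close> makes up for this.\<close>
    also have "\<dots> = (mu B)\<^sup>2 + (8/5 * harm B * mu B) * (5/8) ^ Suc d"
      by (simp add: algebra_simps power2_eq_square)
    finally show ?thesis using k False by (simp add: nat_add_distrib)
  qed
next
  case (sym j k)
  then show ?case by (cases "j = k") (simp_all add: mult.commute abs_minus_commute)
qed

lemma trunc_digit_variance:
  "variance (\<lambda>u. \<Sum>k<n. trunc_digit B ((T ^^ k) u)) \<le> real n * (2 * c * real B + 9 * harm B * mu B)"
proof -
  let ?X = "\<lambda>k u. trunc_digit B ((T ^^ k) u)"
  have sq: "(\<Sum>k<n. ?X k u)\<^sup>2 = (\<Sum>j<n. \<Sum>k<n. ?X j u * ?X k u)" for u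
    by (simp add: power2_eq_square sum_product)
  have "variance (\<lambda>u. \<Sum>k<n. ?X k u) = expectation (\<lambda>u. (\<Sum>k<n. ?X k u)\<^sup>2) - (real n * mu B)\<^sup>2"
    by (subst variance_eq) (auto simp: expectation_sum_trunc_digit sq intro!: Bochner_Integration.integrable_sum integrable_trunc_digit integrable_trunc_digit_mult)
  also have "expectation (\<lambda>u. (\<Sum>k<n. ?X k u)\<^sup>2) = (\<Sum>j<n. \<Sum>k<n. expectation (\<lambda>u. ?X j u * ?X k u))"
    by (simp add: sq integrable_trunc_digit_mult)
  also have "\<dots> - (real n * mu B)\<^sup>2 = (\<Sum>j<n. \<Sum>k<n. expectation (\<lambda>u. ?X j u * ?X k u) - (mu B)\<^sup>2)"
    by (simp add: sum_subtractf power2_eq_square)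
  also have "\<dots> \<le> (\<Sum>j<n. \<Sum>k<n. (8/5 * harm B * mu B) * (5/8) ^ nat \<bar>int j - int k\<bar> + (if j = k then 2 * c * real B else 0))"
    by (intro sum_mono trunc_digit_covariance)
  also have "\<dots> = (\<Sum>j<n. (8/5 * harm B * mu B) * (\<Sum>k<n. (5/8) ^ nat \<bar>int j - int k\<bar>) + 2 * c * real B)"
    by (intro sum.cong refl) (simp add: sum.distrib sum_distrib_left)
  also have "\<dots> \<le> (\<Sum>j<n. (8/5 * harm B * mu B) * (2 / (1 - 5/8)) + 2 * c * real B)"
    using mu_nonneg[of B] harm_nonneg[of B, where 'a = real]
    by (intro sum_mono add_right_mono mult_left_mono sum_power_dist_le) auto
  \<comment> \<open>\<open>8/5 * 2 / (1 - 5/8) = 128/15\<close>, which is then rounded up to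
    9.\<close>
  also have "\<dots> = real n * (128/15 * (harm B * mu B) + 2 * c * real B)" by simp
  also have "\<dots> \<le> real n * (2 * c * real B + 9 * harm B * mu B)"
    using mu_nonneg[of B] harm_nonneg[of B, where 'a = real] mult_nonneg_nonneg[of "harm B" "mu B"]
    by (intro mult_left_mono) auto
  finally show ?thesis .
qed

text \<open>An orbit may reach 0, for instance from \<open>u = 1/2\<close>, and then stays there;
  division by zero gives \<open>dig 0 = 0\<close>.\<close>

lemma T_orbit: "u \<in> {0<..<1} \<Longrightarrow> (T ^^ k) u \<in> {0..<1}"
  by (cases k) (auto simp: T_def frac_lt_1)

text \<open>If no digit up to time \<open>n\<close> reaches \<open>B\<close>, the truncated and the
  true sum agree, and Chebyshev's inequality applies. By invariance each exceptional event
  \<open>D k\<close> has the probability of a first digit at least \<open>B\<close>, so the union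
  bound gives the first term.\<close>

lemma deviation:
  assumes B: "1 \<le> B" and t: "0 < t"
  shows "prob {u. \<bar>(\<Sum>k<n. real_of_int (dig ((T ^^ k) u))) - real n * mu B\<bar> \<ge> t}
    \<le> real n * c / real B + real n * (2 * c * real B + 9 * harm B * mu B) / t\<^sup>2"
proof -
  let ?X = "\<lambda>u. \<Sum>k<n. trunc_digit B ((T ^^ k) u)"
  define A where "A = {u \<in> space M. \<bar>?X u - expectation ?X\<bar> \<ge> t}"
  define D where "D k = {u. B \<le> nat (dig ((T ^^ k) u))}" for k
  have [measurable]: "D k \<in> sets M" for k unfolding D_def by (simp add: sets_M) measurable
  have [measurable]: "A \<in> sets M" unfolding A_def by measurable
  have "integrable M (\<lambda>u. (?X u)\<^sup>2)"
    by (simp add: power2_eq_square sum_product integrable_trunc_digit_mult)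
  then have "prob A \<le> variance ?X / t\<^sup>2"
    unfolding A_def using t by (intro Chebyshev_inequality) auto
  also have "\<dots> \<le> real n * (2 * c * real B + 9 * harm B * mu B) / t\<^sup>2"
    by (intro divide_right_mono trunc_digit_variance) auto
  finally have A: "prob A \<le> real n * (2 * c * real B + 9 * harm B * mu B) / t\<^sup>2" .
  have D: "prob (D k) \<le> c / real B" for k
  proof -
    have "prob (D k) = expectation (indicator (D k))" by (simp add: space_M)
    also have "\<dots> = expectation (\<lambda>u. indicator {u. B \<le> nat (dig u)} ((T ^^ k) u))"
      by (intro Bochner_Integration.integral_cong) (auto simp: D_def indicator_def)
    also have "\<dots> = digit_ge_prob B"
      by (subst expectation_invariant) (auto simp: digit_ge_prob_def space_M)
    finally show ?thesis using digit_ge_prob_le[OF B] by simp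
  qed
  have "prob {u. \<bar>(\<Sum>k<n. real_of_int (dig ((T ^^ k) u))) - real n * mu B\<bar> \<ge> t} \<le> prob (A \<union> (\<Union>k<n. D k))"
  proof (rule finite_measure_mono_AE)
    show "AE u in M. u \<in> {u. \<bar>(\<Sum>k<n. real_of_int (dig ((T ^^ k) u))) - real n * mu B\<bar> \<ge> t}
        \<longrightarrow> u \<in> A \<union> (\<Union>k<n. D k)"
      using AE_M
    proof eventually_elim
      fix u :: real assume u: "u \<in> {0<..<1}"
      \<comment> \<open>Nonnegativity ensures that the conversion by \<open>nat\<close> in
        \<open>trunc_digit\<close> loses nothing.\<close>
      have "dig ((T ^^ k) u) \<ge> 0" for k
        using T_orbit[OF u, of k] by (auto simp: dig_def)
      then have "?X u = (\<Sum>k<n. real_of_int (dig ((T ^^ k) u)))" if "\<And>k. k < n \<Longrightarrow> u \<notin> D k"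
        using that by (intro sum.cong) (auto simp: trunc_digit_def D_def not_le min.absorb3)
      then show "u \<in> {u. \<bar>(\<Sum>k<n. real_of_int (dig ((T ^^ k) u))) - real n * mu B\<bar> \<ge> t}
        \<longrightarrow> u \<in> A \<union> (\<Union>k<n. D k)"
        by (auto simp: A_def expectation_sum_trunc_digit space_M)
    qed
  qed measurable
  also have "\<dots> \<le> prob A + prob (\<Union>k<n. D k)"
    by (intro measure_Un_le) auto
  also have "prob (\<Union>k<n. D k) \<le> (\<Sum>k<n. prob (D k))"
    by (intro measure_UNION_le) auto
  also have "\<dots> \<le> (\<Sum>k<n. c / real B)" by (intro sum_mono D)
  finally show ?thesis using A by simp
qed

text \<open>The truncation level must exceed \<open>n\<close> (so that truncation is rarely active) and be \<open>o(n (ln n)\<^sup>2)\<close> (so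
  that Chebyshev applies), while \<open>ln (level n) \<sim> ln n\<close>.\<close>

definition level :: "nat \<Rightarrow> nat" where "level n = nat \<lceil>real n * ln (real n)\<rceil>"

lemma level_bounds:
  assumes "1 \<le> n"
  shows "real n * ln (real n) \<le> real (level n)" "real (level n) \<le> real n * ln (real n) + 1"
proof -
  have "0 \<le> real n * ln (real n)" using assms by simp
  then show "real n * ln (real n) \<le> real (level n)" "real (level n) \<le> real n * ln (real n) + 1"
    unfolding level_def by linarith+
qed

lemma level_large: "\<forall>\<^sub>F n in sequentially. m \<le> level n"
proof -
  have "\<forall>\<^sub>F n in sequentially. real m \<le> real n * ln (real n)" by real_asymp
  then show ?thesis using eventually_ge_at_top[of 1]
  proof eventually_elim
    case (elim n)
    then show ?case using level_bounds(1)[of n] by linarith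
  qed
qed

text \<open>The exact formula for \<open>mu\<close> gives \<open>c * ln (level n + 1)\<close> up to
  a constant, and \<open>ln (n * ln n) = ln n + ln (ln n)\<close> is asymptotic to
  \<open>ln n\<close>.\<close>

lemma mu_level_tendsto: "(\<lambda>n. mu (level n) / ln (real n)) \<longlonglongrightarrow> c"
proof (rule tendsto_sandwich)
  show "(\<lambda>n. (real m + c * (ln (real n * ln (real n) + 1) - ln (real (m + 1)))) / ln (real n)) \<longlonglongrightarrow> c"
    by real_asymp
  show "(\<lambda>n. (real m + c * (ln (real n * ln (real n) + 2) - ln (real (m + 1)))) / ln (real n)) \<longlonglongrightarrow> c"
    by real_asymp
  have "\<forall>\<^sub>F n in sequentially. m \<le> level n \<and> 1 \<le> n"
    using level_large eventually_ge_at_top[of 1] by eventually_elim simp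
  then have *: "\<forall>\<^sub>F n in sequentially.
     (real m + c * (ln (real n * ln (real n) + 1) - ln (real (m + 1)))) / ln (real n) \<le> mu (level n) / ln (real n) \<and>
     mu (level n) / ln (real n) \<le> (real m + c * (ln (real n * ln (real n) + 2) - ln (real (m + 1)))) / ln (real n)"
  proof eventually_elim
    case (elim n)
    then have n: "1 \<le> n" by simp
    have "0 \<le> real n * ln (real n)" using n by simp
    then have "ln (real n * ln (real n) + 1) \<le> ln (real (level n + 1))"
        "ln (real (level n + 1)) \<le> ln (real n * ln (real n) + 2)"
      using level_bounds[OF n] by (subst ln_le_cancel_iff; simp)+
    then show ?case
      using elim c_pos n by (auto simp: mu_eq intro!: divide_right_mono mult_left_mono)
  qed
  show "\<forall>\<^sub>F n in sequentially.
     (real m + c * (ln (real n * ln (real n) + 1) - ln (real (m + 1)))) / ln (real n) \<le> mu (level n) / ln (real n)"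
    using * by eventually_elim simp
  show "\<forall>\<^sub>F n in sequentially.
     mu (level n) / ln (real n) \<le> (real m + c * (ln (real n * ln (real n) + 2) - ln (real (m + 1)))) / ln (real n)"
    using * by eventually_elim simp
qed

section \<open>The weak law in the rescaled coordinate\<close>

theorem weak_law:
  assumes \<epsilon>: "0 < \<epsilon>"
  shows "(\<lambda>n. prob {u. \<bar>(\<Sum>k<n. real_of_int (dig ((T ^^ k) u))) / (real n * ln (real n)) - c\<bar> > \<epsilon>}) \<longlonglongrightarrow> 0"
    (is "(\<lambda>n. prob (?E n)) \<longlonglongrightarrow> 0")
proof -
  \<comment> \<open>This is the deviation bound at \<open>t = \<epsilon> / 2 * (n * ln n)\<close>,
    with \<open>level n\<close> replaced by \<open>n * ln n\<close> or \<open>n * ln n + 1\<close>.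
    Both summands are of order \<open>1 / ln n\<close>.\<close>
  define r where "r n = c / ln (real n) + real n * (2 * c * (real n * ln (real n) + 1) +
      9 * (1 + ln (real n * ln (real n) + 1)) * (real m + c * ln (real n * ln (real n) + 2)))
      / (\<epsilon> / 2 * (real n * ln (real n)))\<^sup>2" for n :: nat
  have r: "r \<longlonglongrightarrow> 0" unfolding r_def using \<epsilon> c_pos by real_asymp
  have "\<forall>\<^sub>F n in sequentially. dist (mu (level n) / ln (real n)) c < \<epsilon> / 2"
    using mu_level_tendsto \<epsilon> by (intro tendstoD) auto
  then have "\<forall>\<^sub>F n in sequentially. prob (?E n) \<le> r n"
    using level_large eventually_gt_at_top[of 1]
  proof eventually_elim
    case (elim n)
    define B where "B = level n"
    define N where "N = real n * ln (real n)"
    have ln_n: "ln (real n) > 0" and N: "N > 0" using elim by (simp_all add: N_def)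
    have B: "N \<le> real B" "real B \<le> N + 1" "m \<le> B"
      using elim level_bounds[of n] by (auto simp: B_def N_def)
    have B1: "1 \<le> B" using B m_ge_2 by simp
    \<comment> \<open>Half of \<open>\<epsilon>\<close> absorbs the distance of the normalised mean
      from \<open>c\<close>, the other half is left for the fluctuation.\<close>
    have "?E n \<subseteq> {u. \<bar>(\<Sum>k<n. real_of_int (dig ((T ^^ k) u))) - real n * mu B\<bar> \<ge> \<epsilon> / 2 * N}"
    proof safe
      fix u assume u: "\<bar>(\<Sum>k<n. real_of_int (dig ((T ^^ k) u))) / (real n * ln (real n)) - c\<bar> > \<epsilon>"
      define S where "S = (\<Sum>k<n. real_of_int (dig ((T ^^ k) u)))"
      have "\<bar>S / N - c\<bar> > \<epsilon>" using u by (simp add: S_def N_def)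
      moreover have "\<bar>mu B / ln (real n) - c\<bar> < \<epsilon> / 2" using elim by (simp add: dist_real_def B_def)
      moreover have "mu B / ln (real n) = real n * mu B / N" using elim by (simp add: N_def)
      ultimately have "\<epsilon> / 2 \<le> \<bar>S / N - real n * mu B / N\<bar>" by linarith
      also have "\<dots> = \<bar>S - real n * mu B\<bar> / N" using N by (simp flip: diff_divide_distrib)
      finally show "\<epsilon> / 2 * N \<le> \<bar>S - real n * mu B\<bar>" using N by (simp add: field_simps)
    qed
    then have "prob (?E n) \<le> prob {u. \<bar>(\<Sum>k<n. real_of_int (dig ((T ^^ k) u))) - real n * mu B\<bar> \<ge> \<epsilon> / 2 * N}"
      by (intro finite_measure_mono) (auto simp: sets_M)
    also have "\<dots> \<le> real n * c / real B + real n * (2 * c * real B + 9 * harm B * mu B) / (\<epsilon> / 2 * N)\<^sup>2"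
      using \<epsilon> N B1 by (intro deviation) auto
    also have "\<dots> \<le> r n"
      unfolding r_def N_def[symmetric]
    proof (intro add_mono divide_right_mono mult_left_mono mult_mono)
      have "real n * c / real B \<le> real n * c / N"
        using B N c_pos by (intro divide_left_mono) auto
      then show "real n * c / real B \<le> c / ln (real n)" using elim by (simp add: N_def)
      show "harm B \<le> 1 + ln (N + 1)"
        using harm_le_ln[OF B1] B B1 N by (smt (verit) ln_mono of_nat_1 of_nat_le_iff)
      have "ln (real (B + 1)) \<le> ln (N + 2)" using B N by simp
      then have "c * (ln (real (B + 1)) - ln (real (m + 1))) \<le> c * ln (N + 2)"
        using c_pos by (intro mult_left_mono) (auto intro: order_trans[of _ "ln (real (B + 1))"])
      then show "mu B \<le> real m + c * ln (N + 2)"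
        using mu_eq[OF B(3)] by simp
    qed (use B c_pos N mu_nonneg in \<open>auto simp: harm_nonneg\<close>)
    finally show ?case .
  qed
  then show ?thesis
    by (intro tendsto_sandwich[OF _ _ tendsto_const r]) auto
qed

end

subsection \<open>Rescaling to the unit interval\<close>

text \<open>Everything follows from \<open>\<theta> * \<theta> = 1 / m\<close>. The case
  \<open>u = 0\<close> is included: division by zero makes both digits and both images 0.\<close>

lemma T_theta_scaled:
  assumes "n_fraction m" "\<theta> = 1 / sqrt (real m)"
  shows "T_theta \<theta> (\<theta> * u) = \<theta> * n_fraction.T m u"
    and "\<lfloor>1 / (\<theta> * (\<theta> * u))\<rfloor> = n_fraction.dig m u"
proof -
  interpret n_fraction m by fact
  have \<theta>: "\<theta> > 0" "\<theta> * \<theta> = 1 / real m" using m_pos by (auto simp: assms(2))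
  have 1: "1 / (\<theta> * (\<theta> * u)) = real m / u"
    using \<theta> m_pos by (simp flip: mult.assoc)
  then show "\<lfloor>1 / (\<theta> * (\<theta> * u))\<rfloor> = dig u" by (simp add: dig_def)
  have "1 / (\<theta> * u) = \<theta> * (real m / u)"
    using \<theta> by (simp flip: 1)
  then show "T_theta \<theta> (\<theta> * u) = \<theta> * T u"
    using \<theta> by (auto simp: T_theta_def T_def 1 frac_def right_diff_distrib)
qed

lemma S_theta_scaled:
  assumes "n_fraction m" "\<theta> = 1 / sqrt (real m)"
  shows "S_theta \<theta> n (\<theta> * u) = (\<Sum>k<n. real_of_int (n_fraction.dig m ((n_fraction.T m ^^ k) u)))"
proof -
  have T: "(T_theta \<theta> ^^ k) (\<theta> * u) = \<theta> * (n_fraction.T m ^^ k) u" for k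
    by (induction k) (auto simp: T_theta_scaled[OF assms])
  have "S_theta \<theta> n (\<theta> * u) = (\<Sum>k=1..n. real_of_int (n_fraction.dig m ((n_fraction.T m ^^ (k - 1)) u)))"
    by (simp only: S_theta_def digit_def T T_theta_scaled(2)[OF assms])
  also have "\<dots> = (\<Sum>k<n. real_of_int (n_fraction.dig m ((n_fraction.T m ^^ k) u)))"
    by (rule sum.reindex_bij_witness[of _ Suc "\<lambda>k. k - 1"]) auto
  finally show ?thesis .
qed

text \<open>The substitution \<open>x = \<theta> * u\<close> contributes a factor
  \<open>\<theta>\<close>, so the density becomes \<open>c * \<theta>\<^sup>2 / (1 +
  \<theta>\<^sup>2 * u) = c / (m + u)\<close>.\<close>

lemma measure_gamma_theta:
  assumes "n_fraction m" and \<theta>: "\<theta> = 1 / sqrt (real m)" and A: "A \<in> sets borel" "A \<subseteq> {0..\<theta>}"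
  shows "measure (gamma_theta \<theta>) A = measure (n_fraction.M m) {u \<in> {0..1}. \<theta> * u \<in> A}"
proof -
  interpret n_fraction m by fact
  have pos: "\<theta> > 0" and sq: "\<theta>\<^sup>2 = 1 / real m" using m_pos by (auto simp: \<theta> power_divide)
  note [measurable] = A(1)
  have "emeasure (gamma_theta \<theta>) A =
      (\<integral>\<^sup>+x. ennreal (c * (\<theta> / (1 + \<theta> * x))) * indicator A x \<partial>restrict_space lborel {0..\<theta>})"
    unfolding gamma_theta_def c_def sq using A
    by (intro emeasure_density) (auto simp: sets_restrict_space intro!: measurable_restrict_space1)
  also have "\<dots> = (\<integral>\<^sup>+x. ennreal (c * (\<theta> / (1 + \<theta> * x))) * indicator A x * indicator {0..\<theta>} x \<partial>lborel)"
    by (rule nn_integral_restrict_space) auto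
  also have "\<dots> = ennreal \<bar>\<theta>\<bar> * (\<integral>\<^sup>+u. ennreal (c * (\<theta> / (1 + \<theta> * (0 + \<theta> * u)))) * indicator A (0 + \<theta> * u) * indicator {0..\<theta>} (0 + \<theta> * u) \<partial>lborel)"
    using pos by (intro nn_integral_real_affine) auto
  also have "\<dots> = (\<integral>\<^sup>+u. ennreal \<bar>\<theta>\<bar> * (ennreal (c * (\<theta> / (1 + \<theta> * (0 + \<theta> * u)))) * indicator A (0 + \<theta> * u) * indicator {0..\<theta>} (0 + \<theta> * u)) \<partial>lborel)"
    by (rule nn_integral_cmult[symmetric]) measurable
  also have "\<dots> = (\<integral>\<^sup>+u. indicator {u \<in> {0..1}. \<theta> * u \<in> A} u * ennreal (c / (real m + u)) * indicator {0..1} u \<partial>lborel)"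
  proof (rule nn_integral_cong)
    fix u :: real
    have "ennreal \<bar>\<theta>\<bar> * ennreal (c * (\<theta> / (1 + \<theta> * (\<theta> * u)))) = ennreal (c / (real m + u))" if u: "u \<in> {0..1}"
    proof -
      have "\<theta> * (c * (\<theta> / (1 + \<theta> * (\<theta> * u)))) = c * \<theta>\<^sup>2 / (1 + \<theta>\<^sup>2 * u)"
        by (simp add: power2_eq_square mult_ac)
      also have "\<dots> = c / (real m + u)"
        using u m_pos unfolding sq by (simp add: field_simps)
      finally show ?thesis using pos by (simp flip: ennreal_mult')
    qed
    moreover have "\<theta> * u \<in> {0..\<theta>} \<longleftrightarrow> u \<in> {0..1}"
      using pos by (auto simp: zero_le_mult_iff)
    ultimately show "ennreal \<bar>\<theta>\<bar> * (ennreal (c * (\<theta> / (1 + \<theta> * (0 + \<theta> * u)))) * indicator A (0 + \<theta> * u) * indicator {0..\<theta>} (0 + \<theta> * u)) =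
      indicator {u \<in> {0..1}. \<theta> * u \<in> A} u * ennreal (c / (real m + u)) * indicator {0..1} u"
      by (simp add: indicator_def)
  qed
  also have "\<dots> = (\<integral>\<^sup>+u. indicator {u \<in> {0..1}. \<theta> * u \<in> A} u \<partial>M)"
    by (rule nn_integral_M[symmetric]) measurable
  also have "\<dots> = emeasure M {u \<in> {0..1}. \<theta> * u \<in> A}"
    by (rule nn_integral_indicator) measurable
  finally show ?thesis by (simp add: measure_def)
qed

section \<open>Measurability and return to the original measure\<close>

lemma T_theta_measurable [measurable]: "T_theta \<theta> \<in> borel_measurable borel"
  unfolding T_theta_def by measurable

lemma S_theta_measurable [measurable]: "S_theta \<theta> n \<in> borel_measurable borel"
proof -
  have [measurable]: "(T_theta \<theta> ^^ k) \<in> borel_measurable borel" for k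
    by (induction k) (auto intro: measurable_comp)
  show ?thesis unfolding S_theta_def digit_def by measurable
qed

theorem theorem1p3:
  fixes m :: nat and \<theta> \<epsilon> :: real
  assumes "m > 0"
    and "\<not> (\<exists>k::nat. k\<^sup>2 = m)"
    and "\<theta> = 1 / sqrt (real m)"
    and "\<epsilon> > 0"
  shows "(\<lambda>n. measure (gamma_theta \<theta>)
            {x \<in> {0..\<theta>}. \<bar>S_theta \<theta> n x / (real n * ln (real n)) - 1 / ln (1 + \<theta>\<^sup>2)\<bar> > \<epsilon>})
         \<longlonglongrightarrow> 0"
proof -
  \<comment> \<open>As 1 is a square, \<open>m \<ge> 2\<close>, which is the bound behind the
    contraction factor \<open>5/8\<close>.\<close>
  have "m \<noteq> 1" using assms(2)[simplified, rule_format, of 1] by auto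
  with assms(1) have nf: "n_fraction m" by unfold_locales auto
  then interpret n_fraction m .
  have pos: "\<theta> > 0" and c: "1 / ln (1 + \<theta>\<^sup>2) = c"
    using m_pos by (auto simp: assms(3) power_divide c_def)
  have "measure (gamma_theta \<theta>) {x \<in> {0..\<theta>}. \<bar>S_theta \<theta> n x / (real n * ln (real n)) - c\<bar> > \<epsilon>} =
      prob {u. \<bar>(\<Sum>k<n. real_of_int (dig ((T ^^ k) u))) / (real n * ln (real n)) - c\<bar> > \<epsilon>}" for n
  proof -
    let ?A = "{x \<in> {0..\<theta>}. \<bar>S_theta \<theta> n x / (real n * ln (real n)) - c\<bar> > \<epsilon>}"
    have "measure (gamma_theta \<theta>) ?A = prob {u \<in> {0..1}. \<theta> * u \<in> ?A}"
      by (rule measure_gamma_theta[OF nf assms(3)]) auto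
    \<comment> \<open>The restriction to [0, 1] may be dropped because \<open>M\<close> gives no
      mass to the complement.\<close>
    also have "\<dots> = prob {u. \<bar>(\<Sum>k<n. real_of_int (dig ((T ^^ k) u))) / (real n * ln (real n)) - c\<bar> > \<epsilon>}"
      using pos
      by (intro measure_eq_AE eventually_mono[OF AE_M])
         (auto simp: S_theta_scaled[OF nf assms(3)] sets_M)
    finally show ?thesis .
  qed
  then show ?thesis unfolding c using weak_law[OF assms(4)] by simp
qed

end
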